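(* Let $(G,\psi)$ be a vertex-weighted digraph on $[\ell]$ with $\psi(i)=[a_i,b_i]$ ($a_i\le b_i$ integers), and let $v\in[\ell]$. (1) Assume $v$ is a coking in $G$, and let $(G',\psi')$ be obtained from $(G,\psi)$ by the coking elimination operation with respect to $v$. If $0\in\psi(i)$ for every $i\in[\ell]$ and $[a_i,b_i-1]\subseteq\psi(v)$ for every $i\in[\ell]\setminus\{v\}$, then $\chi_{\mathcal{A}(G,\psi)}(t)=\chi_{\mathcal{A}(G',\psi')}(t)$. (2) Assume $v$ is a king in $G$, and let $(G'',\psi'')$ be obtained from $(G,\psi)$ by the king elimination operation with respect to $v$. If $0\in\psi(i)$ for every $i\in[\ell]$ and $[a_i+1,b_i]\subseteq\psi(v)$ for every $i\in[\ell]\setminus\{v\}$, then $\chi_{\mathcal{A}(G,\psi)}(t)=\chi_{\mathcal{A}(G'',\psi'')}(t)$.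
   Context: For integers $a\le b$, $[a,b]=\{n\in\mathbb{Z}: a\le n\le b\}$ (empty if $a>b$) and $[\ell]=[1,\ell]$. A vertex-weighted digraph $(G,\psi)$ on $[\ell]$ consists of a digraph $G$ with vertex set $[\ell]$ and edge set $E_G\subseteq\{(i,j): i\ne j\}$ (both $(i,j)$ and $(j,i)$ may be edges) and a map $\psi$ assigning to each $i\in[\ell]$ an integer interval $\psi(i)=[a_i,b_i]$ with $a_i\le b_i$. The $\psi$-digraphical arrangement $\mathcal{A}(G,\psi)$ in $\mathbb{R}^\ell$ consists of the hyperplanes $x_i-x_j=0$ ($1\le i<j\le\ell$), $x_i-x_j=1$ ($(i,j)\in E_G$), and $x_i=c$ ($c\in\psi(i)$, $i\in[\ell]$). A vertex $v$ is a coking (resp. king) of $G$ if $(u,v)\in E_G$ (resp. $(v,u)\in E_G$) for every $u\ne v$. The coking elimination operation w.r.t. a coking $v$ produces $(G',\psi')$ with $E_{G'}=E_G\setminus\{(i,v): i\ne v\}$, $\psi'(i)=[a_i-1,b_i]$ for $i\ne v$ and $\psi'(v)=[a_v,b_v]$. The king elimination operation w.r.t. a king $v$ produces $(G'',\psi'')$ with $E_{G''}=E_G\setminus\{(v,i): i\ne v\}$, $\psi''(i)=[a_i,b_i+1]$ for $i\ne v$ and $\psi''(v)=[a_v,b_v]$. For an arrangement $\mathcal{A}$ in $\mathbb{R}^\ell$, $L(\mathcal{A})$ is the set of nonempty intersections of subsets of $\mathcal{A}$ (including $\mathbb{R}^\ell$), ordered by reverse inclusion, with Möbius function $\mu(\mathbb{R}^\ell)=1$,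 $\mu(X)=-\sum_{Y\supsetneq X}\mu(Y)$; the characteristic polynomial is $\chi_{\mathcal{A}}(t)=\sum_{X\in L(\mathcal{A})}\mu(X)t^{\dim X}$. *)

theory Defs
  imports "HOL-Analysis.Analysis" "HOL-Computational_Algebra.Polynomial"
begin

text \<open>The vertex set is the finite index type \<open>'n\<close>, so that the ambient space is \<open>real ^ 'n\<close>;
  the interval \<open>\<psi>(i)\<close> is stored by its two endpoints, on which the elimination operations act.\<close>

record 'n vwdigraph =
  dedges :: "('n \<times> 'n) set"
  lower :: "'n \<Rightarrow> int"
  upper :: "'n \<Rightarrow> int"

definition vw_digraph :: "'n vwdigraph \<Rightarrow> bool" where
  "vw_digraph G \<longleftrightarrow> (\<forall>(i, j) \<in> dedges G. i \<noteq> j) \<and> (\<forall>i. lower G i \<le> upper G i)"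

definition weight :: "'n vwdigraph \<Rightarrow> 'n \<Rightarrow> int set" where
  "weight G i = {lower G i..upper G i}"

definition coking :: "'n vwdigraph \<Rightarrow> 'n \<Rightarrow> bool" where
  "coking G v \<longleftrightarrow> (\<forall>u. u \<noteq> v \<longrightarrow> (u, v) \<in> dedges G)"

definition king :: "'n vwdigraph \<Rightarrow> 'n \<Rightarrow> bool" where
  "king G v \<longleftrightarrow> (\<forall>u. u \<noteq> v \<longrightarrow> (v, u) \<in> dedges G)"

definition coking_elimination :: "'n \<Rightarrow> 'n vwdigraph \<Rightarrow> 'n vwdigraph" where
  "coking_elimination v G =
     \<lparr>dedges = dedges G - {(i, v) | i. i \<noteq> v},
      lower = (\<lambda>i. if i = v then lower G i else lower G i - 1),
      upper = upper G\<rparr>"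

definition king_elimination :: "'n \<Rightarrow> 'n vwdigraph \<Rightarrow> 'n vwdigraph" where
  "king_elimination v G =
     \<lparr>dedges = dedges G - {(v, i) | i. i \<noteq> v},
      lower = lower G,
      upper = (\<lambda>i. if i = v then upper G i else upper G i + 1)\<rparr>"

text \<open>An arrangement is the set of its hyperplanes, each a subset of the ambient space. Since
  \<open>x\<^sub>i - x\<^sub>j = 0\<close> is symmetric in \<open>i\<close> and \<open>j\<close>, ranging over \<open>i \<noteq> j\<close> gives the same set of
  hyperplanes as ranging over \<open>i < j\<close> for any ordering of the vertices.\<close>

definition digraphical_arrangement :: "'n::finite vwdigraph \<Rightarrow> (real ^ 'n) set set" where
  "digraphical_arrangement G =
     {{x. x $ i - x $ j = 0} | i j. i \<noteq> j} \<union>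
     {{x. x $ i - x $ j = 1} | i j. (i, j) \<in> dedges G} \<union>
     {{x. x $ i = of_int c} | i c. c \<in> weight G i}"

definition intersection_poset :: "'a set set \<Rightarrow> 'a set set" where
  "intersection_poset \<A> = {\<Inter>\<B> | \<B>. \<B> \<subseteq> \<A> \<and> \<Inter>\<B> \<noteq> {}}"

lemma finite_digraphical_arrangement: "finite (digraphical_arrangement G)"
proof -
  have "digraphical_arrangement G \<subseteq>
      (\<lambda>(i, j). {x. x $ i - x $ j = 0}) ` UNIV \<union> (\<lambda>(i, j). {x. x $ i - x $ j = 1}) ` UNIV \<union>
      (\<Union>i. (\<lambda>c. {x. x $ i = of_int c}) ` weight G i)"
    unfolding digraphical_arrangement_def by fastforce
  then show ?thesis
    by (rule finite_subset) (auto simp: weight_def)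
qed

lemma finite_intersection_poset: "finite \<A> \<Longrightarrow> finite (intersection_poset \<A>)"
  by (rule finite_subset[of _ "Inter ` Pow \<A>"]) (auto simp: intersection_poset_def)

text \<open>The guard only ensures termination: the intersection poset of a finite arrangement is
  finite.\<close>

function mobius :: "'a set set \<Rightarrow> 'a set \<Rightarrow> int" where
  "mobius L X =
     (if finite L \<and> X \<in> L
      then (if X = UNIV then 1 else - (\<Sum>Y \<in> {Y \<in> L. X \<subset> Y}. mobius L Y))
      else 0)"
  by auto
termination
proof (relation "Wellfounded.measure (\<lambda>(L, X). card {Y \<in> L. X \<subset> Y})", goal_cases)
  case (2 L X Y)
  then have "{Z \<in> L. Y \<subset> Z} \<subset> {Z \<in> L. X \<subset> Z}" by auto
  with 2 show ?case by (simp add: psubset_card_mono)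
qed simp

declare mobius.simps [simp del]

definition char_poly :: "'a::euclidean_space set set \<Rightarrow> int poly" where
  "char_poly \<A> =
     (\<Sum>X \<in> intersection_poset \<A>. monom (mobius (intersection_poset \<A>) X) (nat (aff_dim X)))"

end

theory Submission imports Defs "HOL-Number_Theory.Cong" begin

text \<open>Finite field method: for large \<open>q\<close>, the value at \<open>q\<close> of the characteristic polynomial is the
  number of points of \<open>(\<int>/q)\<^sup>n\<close> avoiding all hyperplanes modulo \<open>q\<close>; no primality is needed, because
  all equations have the form \<open>x\<^sub>i - x\<^sub>j = c\<close> once a coordinate with constant value \<open>0\<close> is added. Since
  \<open>0\<close> lies in every weight, these points are integer points in a box contained in \<open>{1..q - 1}\<^sup>n\<close>. If
  \<open>v\<close> is a coking, the position following \<open>x\<^sub>v\<close> is vacant, and deleting it, that is, decreasing by one all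
  coordinates exceeding \<open>x\<^sub>v\<close>, is a bijection onto the points counted for the coking elimination.
  The king case follows by the reflection \<open>x \<mapsto> q - x\<close>.\<close>

section \<open>Characteristic polynomials by point counting\<close>

text \<open>The defining recursion of \<open>mobius\<close> with all terms on one side, the form
  needed for Moebius inversion.\<close>

lemma sum_mobius_superset:
  assumes "finite L" "X \<in> L" "UNIV \<in> L"
  shows "(\<Sum>Y\<in>{Y \<in> L. X \<subseteq> Y}. mobius L Y) = (if X = UNIV then 1 else 0)"
proof (cases "X = UNIV")
  case True
  then have "{Y \<in> L. X \<subseteq> Y} = {UNIV}" using assms by auto
  then show ?thesis using True assms by (simp add: mobius.simps)
next
  case False
  have "{Y \<in> L. X \<subseteq> Y} = insert X {Y \<in> L. X \<subset> Y}" using assms by auto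
  then have "(\<Sum>Y\<in>{Y \<in> L. X \<subseteq> Y}. mobius L Y)
      = mobius L X + (\<Sum>Y\<in>{Y \<in> L. X \<subset> Y}. mobius L Y)"
    using assms(1) by simp
  also have "\<dots> = 0"
    by (subst mobius.simps) (simp add: assms False)
  finally show ?thesis using False by simp
qed

text \<open>Moebius inversion: each point \<open>p\<close> determines the flat \<open>X p\<close> of
  all equations it satisfies, and \<open>q ^ dim Y\<close> counts the points with \<open>X p\<close>
  inside \<open>Y\<close>. After exchanging the sums, only points with \<open>X p = UNIV\<close>
  contribute. The hyperplanes are indexed by equations because distinct equations, such as
  \<open>x i - x j = 0\<close> and \<open>x j - x i = 0\<close>, may define the same
  hyperplane.\<close>

lemma poly_char_poly_eq_card:
  fixes H :: "'t \<Rightarrow> 'a::euclidean_space set" and sat :: "'p \<Rightarrow> 't \<Rightarrow> bool" and q :: nat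
  assumes "finite T" and "finite P"
    and proper: "\<And>t. t \<in> T \<Longrightarrow> H t \<noteq> UNIV"
    and count: "\<And>C. C \<subseteq> T \<Longrightarrow> card {p \<in> P. \<forall>t\<in>C. sat p t} =
                  (if \<Inter>(H ` C) = {} then 0 else q ^ nat (aff_dim (\<Inter>(H ` C))))"
  shows "poly (char_poly (H ` T)) (int q) = int (card {p \<in> P. \<forall>t\<in>T. \<not> sat p t})"
proof -
  let ?L = "intersection_poset (H ` T)"
  define X where "X p = \<Inter>(H ` {t \<in> T. sat p t})" for p
  have finL: "finite ?L" by (simp add: assms finite_intersection_poset)
  have "UNIV \<in> ?L"
    unfolding intersection_poset_def by (auto intro!: exI[of _ "{}"])
  have X_mem: "X p \<in> ?L" if "p \<in> P" for p
  proof -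
    let ?C = "{t \<in> T. sat p t}"
    \<comment> \<open>The point \<open>p\<close> itself makes the count positive, so the real
      intersection cannot be empty.\<close>
    have "{p \<in> P. \<forall>t\<in>?C. sat p t} \<noteq> {}" using that by blast
    then have "card {p \<in> P. \<forall>t\<in>?C. sat p t} \<noteq> 0"
      using \<open>finite P\<close> by (subst card_0_eq) simp_all
    then have "X p \<noteq> {}" using count[of ?C] unfolding X_def by (auto split: if_splits)
    then show ?thesis unfolding intersection_poset_def X_def by blast
  qed
  have X_subset_iff: "X p \<subseteq> \<Inter>(H ` C) \<longleftrightarrow> (\<forall>t\<in>C. sat p t)" if "p \<in> P" "C \<subseteq> T" for p C
  proof
    assume "\<forall>t\<in>C. sat p t"
    then show "X p \<subseteq> \<Inter>(H ` C)" using that unfolding X_def by auto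
  next
    assume sub: "X p \<subseteq> \<Inter>(H ` C)"
    let ?B = "{t \<in> T. sat p t}"
    \<comment> \<open>Adding \<open>C\<close> to the equations satisfied by \<open>p\<close> does
      not change the intersection, hence by \<open>count\<close> not the number of solutions. The
      two nested solution sets therefore coincide, and \<open>p\<close> lies in the larger
      one.\<close>
    have "\<Inter>(H ` (?B \<union> C)) = \<Inter>(H ` ?B)"
      using sub unfolding X_def by (auto simp: image_Un)
    then have "card {p \<in> P. \<forall>t\<in>?B \<union> C. sat p t} = card {p \<in> P. \<forall>t\<in>?B. sat p t}"
      using that by (subst (1 2) count) auto
    then have "{p \<in> P. \<forall>t\<in>?B \<union> C. sat p t} = {p \<in> P. \<forall>t\<in>?B. sat p t}"
      using \<open>finite P\<close> by (intro card_subset_eq) auto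
    then show "\<forall>t\<in>C. sat p t" using that by blast
  qed
  have pow: "int q ^ nat (aff_dim Y) = (\<Sum>p\<in>P. if X p \<subseteq> Y then 1 else 0)" if "Y \<in> ?L" for Y
  proof -
    obtain C where C: "C \<subseteq> T" "Y = \<Inter>(H ` C)" "Y \<noteq> {}"
      using \<open>Y \<in> ?L\<close> unfolding intersection_poset_def by (auto simp: subset_image_iff)
    have "{p \<in> P. X p \<subseteq> Y} = {p \<in> P. \<forall>t\<in>C. sat p t}"
      using X_subset_iff C by auto
    then have "card {p \<in> P. X p \<subseteq> Y} = q ^ nat (aff_dim Y)"
      using count[OF C(1)] C by simp
    moreover have "(\<Sum>p\<in>P. if X p \<subseteq> Y then 1 else 0 :: int) = int (card {p \<in> P. X p \<subseteq> Y})"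
      using \<open>finite P\<close> by (simp add: sum.If_cases Int_def)
    ultimately show ?thesis by simp
  qed
  have X_UNIV: "X p = UNIV \<longleftrightarrow> (\<forall>t\<in>T. \<not> sat p t)" for p
    using proper unfolding X_def by auto
  have "poly (char_poly (H ` T)) (int q) = (\<Sum>Y\<in>?L. mobius ?L Y * int q ^ nat (aff_dim Y))"
    unfolding char_poly_def by (simp add: poly_sum poly_monom)
  also have "\<dots> = (\<Sum>Y\<in>?L. \<Sum>p\<in>P. if X p \<subseteq> Y then mobius ?L Y else 0)"
    by (intro sum.cong refl) (simp add: pow sum_distrib_left if_distrib cong: if_cong)
  also have "\<dots> = (\<Sum>p\<in>P. \<Sum>Y\<in>?L. if X p \<subseteq> Y then mobius ?L Y else 0)"
    by (rule sum.swap)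
  also have "\<dots> = (\<Sum>p\<in>P. \<Sum>Y\<in>{Y \<in> ?L. X p \<subseteq> Y}. mobius ?L Y)"
    by (rule sum.cong[OF refl]) (simp add: sum.If_cases finL Int_def)
  also have "\<dots> = (\<Sum>p\<in>P. if X p = UNIV then 1 else 0)"
    by (rule sum.cong[OF refl]) (intro sum_mobius_superset finL X_mem \<open>UNIV \<in> ?L\<close>)
  also have "\<dots> = int (card {p \<in> P. \<forall>t\<in>T. \<not> sat p t})"
    using \<open>finite P\<close> by (simp add: sum.If_cases Int_def X_UNIV)
  finally show ?thesis .
qed

section \<open>Difference equations over the reals and modulo q\<close>

text \<open>The index \<open>None\<close> stands for an additional coordinate with constant value \<open>0\<close>, so that
  \<open>x\<^sub>i = c\<close> becomes the difference equation \<open>(Some i, None, c)\<close>.\<close>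

definition coord :: "('n \<Rightarrow> 'a::zero) \<Rightarrow> 'n option \<Rightarrow> 'a" where
  "coord x k = (case k of None \<Rightarrow> 0 | Some i \<Rightarrow> x i)"

lemma coord_simps [simp]: "coord x None = 0" "coord x (Some i) = x i"
  by (simp_all add: coord_def)

type_synonym 'n diff_eq = "'n option \<times> 'n option \<times> int"

definition diff_hyperplane :: "'n::finite diff_eq \<Rightarrow> (real ^ 'n) set" where
  "diff_hyperplane = (\<lambda>(i, j, c). {x. coord (($) x) i - coord (($) x) j = of_int c})"

definition flat :: "'n::finite diff_eq set \<Rightarrow> (real ^ 'n) set" where
  "flat C = \<Inter>(diff_hyperplane ` C)"

definition mod_sat :: "nat \<Rightarrow> ('n \<Rightarrow> int) \<Rightarrow> 'n diff_eq \<Rightarrow> bool" where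
  "mod_sat q p = (\<lambda>(i, j, c). int q dvd coord p i - coord p j - c)"

text \<open>Residue classes are represented by integers, so that one type serves every modulus and
  the order of the representatives is available later.\<close>

definition residue_vectors :: "nat \<Rightarrow> ('n \<Rightarrow> int) set" where
  "residue_vectors q = {p. \<forall>i. p i \<in> {0..<int q}}"

definition mod_flat :: "nat \<Rightarrow> 'n diff_eq set \<Rightarrow> ('n \<Rightarrow> int) set" where
  "mod_flat q C = {p \<in> residue_vectors q. \<forall>t\<in>C. mod_sat q p t}"

lemma residue_vectors_PiE: "residue_vectors q = (\<Pi>\<^sub>E i\<in>UNIV. {0..<int q})"
  by (auto simp: residue_vectors_def PiE_def Pi_def)

lemma finite_residue_vectors: "finite (residue_vectors q :: ('n::finite \<Rightarrow> int) set)"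
  by (simp add: residue_vectors_PiE finite_PiE)

lemma mod_flat_subset: "mod_flat q C \<subseteq> residue_vectors q"
  by (auto simp: mod_flat_def)

lemma finite_mod_flat: "finite (mod_flat q (C :: 'n::finite diff_eq set))"
  by (simp add: mod_flat_def finite_residue_vectors)

lemma flat_insert: "flat (insert t C) = flat C \<inter> diff_hyperplane t"
  by (auto simp: flat_def)

lemma mod_flat_insert: "mod_flat q (insert t C) = {p \<in> mod_flat q C. mod_sat q p t}"
  by (auto simp: mod_flat_def)

text \<open>The normal form that makes the library facts on affine hyperplanes applicable.\<close>

lemma diff_hyperplane_eq_inner:
  "diff_hyperplane (i, j, c) = {x. ((case i of None \<Rightarrow> 0 | Some i \<Rightarrow> axis i 1) -
      (case j of None \<Rightarrow> 0 | Some j \<Rightarrow> axis j 1)) \<bullet> x = of_int c}"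
  by (auto simp: diff_hyperplane_def inner_diff_left inner_axis' coord_def split: option.splits)

lemma affine_flat: "affine (flat C)"
  unfolding flat_def
proof (rule affine_Inter)
  fix S assume "S \<in> diff_hyperplane ` C"
  then show "affine S" by (auto simp: diff_hyperplane_eq_inner affine_hyperplane)
qed

section \<open>Connected components of a system of difference equations\<close>

text \<open>Every equation is read as an undirected edge between its two indices; linked indices lie
  in the same component.\<close>

definition linked :: "'n diff_eq set \<Rightarrow> ('n option \<times> 'n option) set" where
  "linked C = {(i, j). \<exists>c. (i, j, c) \<in> C \<or> (j, i, c) \<in> C}\<^sup>*"

text \<open>Adding the equations along a path fixes the difference of its end coordinates. The point
  is that one integer \<open>d\<close> serves both the reals and every modulus.\<close>

lemma linked_difference:
  fixes C :: "'n::finite diff_eq set"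
  assumes "(i, j) \<in> linked C"
  obtains d :: int where "\<And>x. x \<in> flat C \<Longrightarrow> coord (($) x) i - coord (($) x) j = of_int d"
    and "\<And>q p. p \<in> mod_flat q C \<Longrightarrow> int q dvd coord p i - coord p j - d"
proof -
  have "\<exists>d::int. (\<forall>x\<in>flat C. coord (($) x) i - coord (($) x) j = of_int d) \<and>
      (\<forall>q. \<forall>p\<in>mod_flat q C. int q dvd coord p i - coord p j - d)"
    using assms unfolding linked_def
  proof (induction rule: rtrancl_induct)
    case base
    then show ?case by (intro exI[of _ 0]) simp
  next
    case (step j k)
    then obtain d :: int where d: "\<forall>x\<in>flat C. coord (($) x) i - coord (($) x) j = of_int d"
      "\<forall>q. \<forall>p\<in>mod_flat q C. int q dvd coord p i - coord p j - d" by blast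
    from step obtain c where c: "(j, k, c) \<in> C \<or> (k, j, c) \<in> C" by auto
    \<comment> \<open>The last edge may be traversed against the direction of its equation, which
      changes the sign.\<close>
    define e where "e = (if (j, k, c) \<in> C then c else - c)"
    have "coord (($) x) j - coord (($) x) k = of_int e" if "x \<in> flat C" for x
    proof -
      have "x \<in> diff_hyperplane (j, k, c)" if "(j, k, c) \<in> C"
        using that \<open>x \<in> flat C\<close> by (auto simp: flat_def)
      moreover have "x \<in> diff_hyperplane (k, j, c)" if "(k, j, c) \<in> C"
        using that \<open>x \<in> flat C\<close> by (auto simp: flat_def)
      ultimately show ?thesis using c by (auto simp: diff_hyperplane_def e_def)
    qed
    moreover have "int q dvd coord p j - coord p k - e" if p: "p \<in> mod_flat q C" for q p
    proof (cases "(j, k, c) \<in> C")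
      case True
      then show ?thesis using p by (auto simp: mod_flat_def mod_sat_def e_def)
    next
      case False
      then have "int q dvd coord p k - coord p j - c"
        using p c by (auto simp: mod_flat_def mod_sat_def)
      then have "int q dvd - (coord p k - coord p j - c)" by (simp only: dvd_minus_iff)
      then show ?thesis using False by (simp add: e_def algebra_simps)
    qed
    ultimately have e: "\<forall>x\<in>flat C. coord (($) x) j - coord (($) x) k = of_int e"
      "\<forall>q. \<forall>p\<in>mod_flat q C. int q dvd coord p j - coord p k - e" by auto
    have "int q dvd coord p i - coord p k - (d + e)" if "p \<in> mod_flat q C" for q p
    proof -
      have "int q dvd (coord p i - coord p j - d) + (coord p j - coord p k - e)"
        using d e that by (intro dvd_add) auto
      then show ?thesis by (simp add: algebra_simps)
    qed
    moreover have "coord (($) x) i - coord (($) x) k = of_int (d + e)" if "x \<in> flat C" for x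
      using bspec[OF d(1) that] bspec[OF e(1) that] by simp
    ultimately show ?case by blast
  qed
  then show ?thesis using that by blast
qed

text \<open>The indicator of the component of \<open>i\<close> preserves all equations of
  \<open>C\<close> when added to a solution, but changes the difference of \<open>i\<close> and
  \<open>j\<close> by one. Subtracting its value at \<open>None\<close> keeps the extra coordinate
  at \<open>0\<close>.\<close>

lemma not_linked_shift:
  assumes "(i, j) \<notin> linked C"
  obtains f :: "'n \<Rightarrow> int" where "\<And>a b c. (a, b, c) \<in> C \<Longrightarrow> coord f a = coord f b"
    and "coord f i - coord f j = 1"
proof -
  define g :: "'n option \<Rightarrow> int" where "g k = (if (i, k) \<in> linked C then 1 else 0)" for k
  define f where "f k = g (Some k) - g None" for k
  have f: "coord f k = g k - g None" for k
    by (cases k) (auto simp: f_def)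
  have "g a = g b" if "(a, b, c) \<in> C" for a b c
  proof -
    let ?R = "{(i, j). \<exists>c. (i, j, c) \<in> C \<or> (j, i, c) \<in> C}"
    have "(a, b) \<in> ?R" "(b, a) \<in> ?R" using that by auto
    then show ?thesis unfolding g_def linked_def by (meson rtrancl.rtrancl_into_rtrancl)
  qed
  then have "coord f a = coord f b" if "(a, b, c) \<in> C" for a b c
    using that f by metis
  moreover have "coord f i - coord f j = 1"
    unfolding f using assms by (simp add: g_def linked_def)
  ultimately show ?thesis using that by blast
qed

text \<open>Translation by multiples of \<open>f\<close> acts on the solutions of \<open>C\<close>
  modulo \<open>q\<close>. Along each orbit the defect of the new equation takes every residue
  exactly once, so one solution in \<open>q\<close> satisfies it. Since the defect grows in steps of
  exactly \<open>1\<close>, this works for composite \<open>q\<close> too.\<close>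

lemma card_mod_flat_transversal:
  fixes f :: "'n::finite \<Rightarrow> int"
  assumes "q > 0" and f: "\<And>a b c. (a, b, c) \<in> C \<Longrightarrow> coord f a = coord f b"
    and ij: "coord f i - coord f j = 1"
  shows "card (mod_flat q C) = card (mod_flat q (insert (i, j, c) C)) * q"
proof -
  define shift where "shift p s = (\<lambda>k. (p k + s * f k) mod int q)" for p :: "'n \<Rightarrow> int" and s
  define off where "off p = (coord p i - coord p j - c) mod int q" for p
  have coord_shift: "[coord (shift p s) k = coord p k + s * coord f k] (mod int q)" for p s k
    by (cases k) (auto simp: shift_def cong_def)
  have diff_shift: "[coord (shift p s) a - coord (shift p s) b - e
      = coord p a - coord p b - e + s * (coord f a - coord f b)] (mod int q)" for p s a b e
  proof -
    have "[coord (shift p s) a - coord (shift p s) b - e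
        = (coord p a + s * coord f a) - (coord p b + s * coord f b) - e] (mod int q)"
      by (intro cong_diff coord_shift cong_refl)
    then show ?thesis by (simp add: algebra_simps)
  qed
  have shift_res: "shift p s \<in> residue_vectors q" for p s
    using \<open>q > 0\<close> by (auto simp: shift_def residue_vectors_def)
  have shift_mem: "shift p s \<in> mod_flat q C" if "p \<in> mod_flat q C" for p s
  proof -
    have "mod_sat q (shift p s) (a, b, e)" if "(a, b, e) \<in> C" for a b e
    proof -
      have "int q dvd coord p a - coord p b - e"
        using that \<open>p \<in> mod_flat q C\<close> by (auto simp: mod_flat_def mod_sat_def)
      then show ?thesis
        using diff_shift[of p s a b e] f[OF that] by (simp add: mod_sat_def cong_dvd_iff)
    qed
    then show ?thesis using shift_res by (auto simp: mod_flat_def)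
  qed
  have off_shift: "off (shift p s) = (off p + s) mod int q" for p s
    using diff_shift[of p s i j c] ij by (simp add: off_def cong_def mod_simps)
  have mem_iff: "p \<in> mod_flat q (insert (i, j, c) C) \<longleftrightarrow> p \<in> mod_flat q C \<and> off p = 0" for p
    by (auto simp: mod_flat_insert mod_sat_def off_def dvd_eq_mod_eq_0)
  have shift_shift: "shift (shift p s) (- s) = p" "shift (shift p (- s)) s = p"
    if "p \<in> residue_vectors q" for p s
    using that by (auto simp: shift_def residue_vectors_def mod_simps algebra_simps fun_eq_iff)
  have "bij_betw (\<lambda>(p, s). shift p s) (mod_flat q (insert (i, j, c) C) \<times> {0..<int q}) (mod_flat q C)"
  \<comment> \<open>Shifting back by the defect is the only way to reach defect
    \<open>0\<close>.\<close>
  proof (rule bij_betw_byWitness[where f' = "\<lambda>p. (shift p (- off p), off p)"])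
    show "\<forall>a\<in>mod_flat q (insert (i, j, c) C) \<times> {0..<int q}.
        (\<lambda>p. (shift p (- off p), off p)) (case a of (p, s) \<Rightarrow> shift p s) = a"
      by (auto simp: mem_iff off_shift shift_shift mod_flat_subset[THEN subsetD])
    show "\<forall>a'\<in>mod_flat q C. (case (shift a' (- off a'), off a') of (p, s) \<Rightarrow> shift p s) = a'"
      by (auto simp: shift_shift mod_flat_subset[THEN subsetD])
    show "(\<lambda>(p, s). shift p s) ` (mod_flat q (insert (i, j, c) C) \<times> {0..<int q}) \<subseteq> mod_flat q C"
      by (auto simp: mem_iff shift_mem)
    show "(\<lambda>p. (shift p (- off p), off p)) ` mod_flat q C
        \<subseteq> mod_flat q (insert (i, j, c) C) \<times> {0..<int q}"
      using \<open>q > 0\<close> by (auto simp: mem_iff shift_mem off_shift) (auto simp: off_def)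
  qed
  from bij_betw_same_card[OF this] show ?thesis
    by (simp add: card_cartesian_product)
qed

text \<open>The line through a solution in direction \<open>f\<close> stays in the flat and crosses
  the new hyperplane without lying in it, so the dimension drops by exactly one.\<close>

lemma aff_dim_flat_transversal:
  fixes f :: "'n::finite \<Rightarrow> int"
  assumes f: "\<And>a b c. (a, b, c) \<in> C \<Longrightarrow> coord f a = coord f b"
    and ij: "coord f i - coord f j = 1" and "flat C \<noteq> {}"
  shows "flat (insert (i, j, c) C) \<noteq> {}"
    and "aff_dim (flat (insert (i, j, c) C)) = aff_dim (flat C) - 1"
proof -
  obtain x where x: "x \<in> flat C" using assms by auto
  define y where "y s = (\<chi> k. x $ k + s * of_int (f k))" for s :: real
  have coord_y: "coord (($) (y s)) k = coord (($) x) k + s * of_int (coord f k)" for s k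
    by (cases k) (auto simp: y_def)
  have y_mem: "y s \<in> flat C" for s
    unfolding flat_def
  proof (rule INT_I)
    fix t assume t: "t \<in> C"
    obtain a b e where abe: "t = (a, b, e)" by (cases t)
    have "x \<in> diff_hyperplane t" using x t by (auto simp: flat_def)
    then show "y s \<in> diff_hyperplane t"
      using f[of a b e] t by (simp add: abe diff_hyperplane_def coord_y)
  qed
  define s where "s = of_int c - (coord (($) x) i - coord (($) x) j)"
  have diff_y: "coord (($) (y r)) i - coord (($) (y r)) j = of_int c - s + r" for r
  proof -
    have "coord (($) (y r)) i - coord (($) (y r)) j
        = coord (($) x) i - coord (($) x) j + r * of_int (coord f i - coord f j)"
      by (simp add: coord_y algebra_simps)
    then show ?thesis unfolding ij s_def by simp
  qed
  have "y s \<in> diff_hyperplane (i, j, c)" "y (s + 1) \<notin> diff_hyperplane (i, j, c)"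
    using diff_y by (auto simp: diff_hyperplane_def)
  then have ne: "flat C \<inter> diff_hyperplane (i, j, c) \<noteq> {}" "\<not> flat C \<subseteq> diff_hyperplane (i, j, c)"
    using y_mem by auto
  then show "flat (insert (i, j, c) C) \<noteq> {}" by (simp add: flat_insert)
  show "aff_dim (flat (insert (i, j, c) C)) = aff_dim (flat C) - 1"
    using ne unfolding flat_insert diff_hyperplane_eq_inner
    by (simp add: aff_dim_affine_Int_hyperplane[OF affine_flat])
qed

section \<open>Counting solutions modulo large \<open>q\<close>\<close>

text \<open>A new equation within one component is either redundant or contradictory; between two
  components it divides the count by \<open>q\<close> and lowers the dimension by one.\<close>

lemma card_mod_flat_insert:
  fixes C :: "'n::finite diff_eq set"
  assumes IH: "\<forall>\<^sub>F q in sequentially.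
      card (mod_flat q C) = (if flat C = {} then 0 else q ^ nat (aff_dim (flat C)))"
  shows "\<forall>\<^sub>F q in sequentially. card (mod_flat q (insert (i, j, c) C)) =
      (if flat (insert (i, j, c) C) = {} then 0 else q ^ nat (aff_dim (flat (insert (i, j, c) C))))"
proof (cases "flat C = {}")
  case True
  have "mod_flat q (insert (i, j, c) C) = {}" if "mod_flat q C = {}" for q
    using that by (auto simp: mod_flat_insert)
  then show ?thesis
    using IH True by (auto elim!: eventually_mono simp: finite_mod_flat flat_insert)
next
  case nonempty: False
  show ?thesis
  proof (cases "(i, j) \<in> linked C")
    case True
    then obtain d where d: "\<And>x. x \<in> flat C \<Longrightarrow> coord (($) x) i - coord (($) x) j = of_int d"
      "\<And>q p. p \<in> mod_flat q C \<Longrightarrow> int q dvd coord p i - coord p j - d"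
      by (erule linked_difference)
    show ?thesis
    proof (cases "c = d")
      case True
      have "flat (insert (i, j, c) C) = flat C"
        using d(1) True by (auto simp: flat_insert diff_hyperplane_def)
      moreover have "mod_flat q (insert (i, j, c) C) = mod_flat q C" for q
        using d(2) True by (auto simp: mod_flat_insert mod_sat_def)
      ultimately show ?thesis using IH by (simp only:)
    next
      case False
      then have empty: "flat (insert (i, j, c) C) = {}"
        using d(1) by (auto simp: flat_insert diff_hyperplane_def)
      \<comment> \<open>Modulo \<open>q\<close> a contradictory equation can have solutions only if
        \<open>q\<close> divides the nonzero number \<open>c - d\<close>, which is impossible for
        large \<open>q\<close>.\<close>
      have "mod_flat q (insert (i, j, c) C) = {}" if "q > nat \<bar>c - d\<bar>" for q
      proof (rule ccontr)
        assume "mod_flat q (insert (i, j, c) C) \<noteq> {}"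
        then obtain p where p: "p \<in> mod_flat q C" "int q dvd coord p i - coord p j - c"
          by (auto simp: mod_flat_insert mod_sat_def)
        from dvd_diff[OF d(2)[OF p(1)] p(2)] have "int q dvd c - d" by simp
        with False that show False using dvd_imp_le_int[of "c - d" "int q"] by simp
      qed
      then show ?thesis
        using empty by (auto intro!: eventually_mono[OF eventually_gt_at_top[of "nat \<bar>c - d\<bar>"]])
    qed
  next
    case False
    then obtain f :: "'n \<Rightarrow> int" where f: "\<And>a b c. (a, b, c) \<in> C \<Longrightarrow> coord f a = coord f b"
      "coord f i - coord f j = 1" by (erule not_linked_shift)
    let ?D = "flat (insert (i, j, c) C)"
    have D: "?D \<noteq> {}" "aff_dim ?D = aff_dim (flat C) - 1"
      by (rule aff_dim_flat_transversal[of C f]; use f nonempty in blast)+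
    \<comment> \<open>This keeps \<open>nat\<close> from truncating: the empty set has affine
      dimension \<open>-1\<close>.\<close>
    then have "aff_dim ?D \<ge> 0"
      using aff_dim_geq[of ?D] aff_dim_empty[of ?D] by linarith
    with D have dim: "nat (aff_dim (flat C)) = Suc (nat (aff_dim ?D))" by simp
    have card: "card (mod_flat q C) = card (mod_flat q (insert (i, j, c) C)) * q" if "q > 0" for q
      using that f by (rule card_mod_flat_transversal)
    show ?thesis
      using IH eventually_gt_at_top[of 0]
      by eventually_elim (use nonempty D dim card in auto)
  qed
qed

lemma eventually_card_mod_flat:
  fixes C :: "'n::finite diff_eq set"
  assumes "finite C"
  shows "\<forall>\<^sub>F q in sequentially.
      card (mod_flat q C) = (if flat C = {} then 0 else q ^ nat (aff_dim (flat C)))"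
  using assms
proof (induction C rule: finite_induct)
  case empty
  then show ?case
    by (simp add: flat_def mod_flat_def residue_vectors_PiE card_PiE)
next
  case (insert t C)
  then show ?case by (cases t) (simp only: card_mod_flat_insert)
qed

section \<open>Digraphical arrangements\<close>

definition digraph_eqs :: "'n vwdigraph \<Rightarrow> 'n diff_eq set" where
  "digraph_eqs G =
     {(Some i, Some j, 0) | i j. i \<noteq> j} \<union>
     {(Some i, Some j, 1) | i j. (i, j) \<in> dedges G} \<union>
     {(Some i, None, c) | i c. c \<in> weight G i}"

lemma finite_digraph_eqs: "finite (digraph_eqs (G :: 'n::finite vwdigraph))"
proof (rule finite_subset)
  show "digraph_eqs G \<subseteq> UNIV \<times> UNIV \<times> ({0, 1} \<union> (\<Union>i. weight G i))"
    unfolding digraph_eqs_def by auto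
qed (simp add: weight_def)

lemma ball_digraph_eqs:
  "(\<forall>t\<in>digraph_eqs G. P t) \<longleftrightarrow>
     (\<forall>i j. i \<noteq> j \<longrightarrow> P (Some i, Some j, 0)) \<and>
     (\<forall>(i, j)\<in>dedges G. P (Some i, Some j, 1)) \<and>
     (\<forall>i. \<forall>c\<in>weight G i. P (Some i, None, c))"
  unfolding digraph_eqs_def by blast

lemma image_Collect2: "f ` {g i j | i j. P i j} = {f (g i j) | i j. P i j}"
  by blast

lemma image_digraph_eqs: "diff_hyperplane ` digraph_eqs G = digraphical_arrangement G"
  unfolding digraph_eqs_def digraphical_arrangement_def image_Un image_Collect2
  by (simp add: diff_hyperplane_def)

lemma diff_hyperplane_not_UNIV:
  assumes "k \<noteq> Some i"
  shows "diff_hyperplane (Some i, k, c) \<noteq> UNIV"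
proof -
  have "axis i (of_int c + 1) \<notin> diff_hyperplane (Some i, k, c)"
    using assms by (cases k) (auto simp: diff_hyperplane_def axis_def)
  then show ?thesis by blast
qed

lemma eventually_poly_char_poly:
  fixes G :: "'n::finite vwdigraph"
  assumes "vw_digraph G"
  shows "\<forall>\<^sub>F q in sequentially. poly (char_poly (digraphical_arrangement G)) (int q) =
      int (card {p \<in> residue_vectors q. \<forall>t\<in>digraph_eqs G. \<not> mod_sat q p t})"
proof -
  have proper: "\<forall>t\<in>digraph_eqs G. diff_hyperplane t \<noteq> UNIV"
    unfolding ball_digraph_eqs using assms
    by (auto simp: diff_hyperplane_not_UNIV vw_digraph_def)
  \<comment> \<open>Each subsystem has its own bound on \<open>q\<close>; as there are finitely
    many, a common bound exists.\<close>
  have "\<forall>\<^sub>F q in sequentially. \<forall>C\<in>Pow (digraph_eqs G).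
      card (mod_flat q C) = (if flat C = {} then 0 else q ^ nat (aff_dim (flat C)))"
    using finite_digraph_eqs[of G]
    by (intro eventually_ball_finite) (blast intro: eventually_card_mod_flat finite_subset)+
  then show ?thesis
  proof eventually_elim
    case (elim q)
    show ?case
      unfolding image_digraph_eqs[symmetric]
      by (rule poly_char_poly_eq_card)
        (use elim proper finite_digraph_eqs finite_residue_vectors in
          \<open>auto simp: flat_def mod_flat_def\<close>)
  qed
qed

section \<open>Points modulo \<open>q\<close> as integer points in a box\<close>

definition box_points :: "int \<Rightarrow> 'n vwdigraph \<Rightarrow> ('n \<Rightarrow> int) set" where
  "box_points q G = {p. (\<forall>i. upper G i < p i \<and> p i < q + lower G i) \<and> inj p \<and>
     (\<forall>(i, j)\<in>dedges G. p i - p j \<noteq> 1)}"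

text \<open>Because \<open>0\<close> lies in every weight, the forbidden residues of a coordinate
  are the two ends of \<open>{0..<q}\<close>. The remaining values lie in \<open>{1..q - 1}\<close>,
  where the other congruences become equalities.\<close>

lemma mod_complement_eq_box_points:
  fixes G :: "'n vwdigraph"
  assumes zero: "\<And>i. 0 \<in> weight G i"
  shows "{p \<in> residue_vectors q. \<forall>t\<in>digraph_eqs G. \<not> mod_sat q p t} = box_points (int q) G"
proof (intro set_eqI)
  fix p :: "'n \<Rightarrow> int"
  have le: "lower G i \<le> 0" "0 \<le> upper G i" for i using zero[of i] by (auto simp: weight_def)
  have small: "int q dvd z \<longleftrightarrow> z = 0" if "\<bar>z\<bar> < int q" for z
    using that by (metis abs_of_nat dvd_0_right dvd_imp_le_int linorder_not_le)
  have box: "(0 \<le> p i \<and> p i < int q) \<and> (\<forall>c\<in>weight G i. \<not> int q dvd p i - c) \<longleftrightarrow>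
      upper G i < p i \<and> p i < int q + lower G i" for i
  proof safe
    assume *: "0 \<le> p i" "p i < int q" "\<forall>c\<in>weight G i. \<not> int q dvd p i - c"
    show "upper G i < p i"
    proof (rule ccontr)
      assume "\<not> upper G i < p i"
      then have "p i \<in> weight G i" using * le[of i] by (auto simp: weight_def)
      then show False using * by fastforce
    qed
    show "p i < int q + lower G i"
    proof (rule ccontr)
      assume "\<not> p i < int q + lower G i"
      \<comment> \<open>The negative elements of the weight exclude the top representatives.\<close>
      then have "p i - int q \<in> weight G i" using * le[of i] by (auto simp: weight_def)
      then show False using * by fastforce
    qed
  next
    fix c
    assume *: "upper G i < p i" "p i < int q + lower G i" "c \<in> weight G i" "int q dvd p i - c"
    then have "0 < p i - c" "p i - c < int q" by (auto simp: weight_def)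
    with *(4) show False using zdvd_not_zless by blast
  qed (use le[of i] in auto)
  have "p \<in> residue_vectors q \<and> (\<forall>t\<in>digraph_eqs G. \<not> mod_sat q p t) \<longleftrightarrow>
      (\<forall>i. (0 \<le> p i \<and> p i < int q) \<and> (\<forall>c\<in>weight G i. \<not> int q dvd p i - c)) \<and>
      (\<forall>i j. i \<noteq> j \<longrightarrow> \<not> int q dvd p i - p j) \<and>
      (\<forall>(i, j)\<in>dedges G. \<not> int q dvd p i - p j - 1)"
    by (auto simp: ball_digraph_eqs residue_vectors_def mod_sat_def)
  also have "\<dots> \<longleftrightarrow> p \<in> box_points (int q) G"
    unfolding box box_points_def mem_Collect_eq
  proof (intro conj_cong refl)
    assume *: "\<forall>i. upper G i < p i \<and> p i < int q + lower G i"
    have range: "1 \<le> p i" "p i \<le> int q - 1" for i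
      using spec[OF *, of i] le[of i] by auto
    have "\<bar>p i - p j\<bar> < int q" for i j
      using range[of i] range[of j] by auto
    then show "(\<forall>i j. i \<noteq> j \<longrightarrow> \<not> int q dvd p i - p j) \<longleftrightarrow> inj p"
      by (auto simp: small inj_on_def)
    \<comment> \<open>Differences are at most \<open>q - 2\<close> in absolute value, which leaves
      room for the extra \<open>1\<close>.\<close>
    have "\<bar>p i - p j - 1\<bar> < int q" for i j
      using range[of i] range[of j] by auto
    then show "(\<forall>(i, j)\<in>dedges G. \<not> int q dvd p i - p j - 1) \<longleftrightarrow>
        (\<forall>(i, j)\<in>dedges G. p i - p j \<noteq> 1)"
      by (simp add: small)
  qed
  finally show "p \<in> {p \<in> residue_vectors q. \<forall>t\<in>digraph_eqs G. \<not> mod_sat q p t} \<longleftrightarrow>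
      p \<in> box_points (int q) G" by simp
qed

lemma eventually_poly_eq_card_box_points:
  fixes G :: "'n::finite vwdigraph"
  assumes "vw_digraph G" "\<And>i. 0 \<in> weight G i"
  shows "\<forall>\<^sub>F q in sequentially. poly (char_poly (digraphical_arrangement G)) (int q) =
      int (card (box_points (int q) G))"
  using eventually_poly_char_poly[OF assms(1)]
  by (simp add: assms(2) mod_complement_eq_box_points)

text \<open>Agreement at all large natural numbers gives the difference of the polynomials
  infinitely many roots.\<close>

lemma char_poly_eqI:
  fixes G H :: "'n::finite vwdigraph"
  assumes "vw_digraph G" "\<And>i. 0 \<in> weight G i" "vw_digraph H" "\<And>i. 0 \<in> weight H i"
    and card: "\<And>q. card (box_points q G) = card (box_points q H)"
  shows "char_poly (digraphical_arrangement G) = char_poly (digraphical_arrangement H)"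
    (is "?f = ?g")
proof (rule ccontr)
  assume "?f \<noteq> ?g"
  then have "finite {x. poly (?f - ?g) x = 0}" by (intro poly_roots_finite) simp
  moreover have "\<forall>\<^sub>F q in sequentially. poly ?f (int q) = poly ?g (int q)"
    using eventually_poly_eq_card_box_points[OF assms(1,2)]
      eventually_poly_eq_card_box_points[OF assms(3,4)]
    by eventually_elim (simp add: card)
  then obtain N where "\<And>q. q \<ge> N \<Longrightarrow> poly (?f - ?g) (int q) = 0"
    by (auto simp: eventually_at_top_linorder)
  then have "int ` {N..} \<subseteq> {x. poly (?f - ?g) x = 0}" by auto
  ultimately have "finite (int ` {N..})" by (rule rev_finite_subset)
  then show False by (simp add: finite_image_iff infinite_Ici)
qed

section \<open>Elimination of cokings and kings\<close>

lemma card_box_points_coking_elimination: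
  fixes G :: "'n vwdigraph"
  assumes "vw_digraph G" "coking G v" and zero: "\<And>i. 0 \<in> weight G i"
    and sub: "\<And>i. i \<noteq> v \<Longrightarrow> {lower G i..upper G i - 1} \<subseteq> weight G v"
  shows "card (box_points q G) = card (box_points q (coking_elimination v G))"
proof -
  let ?G' = "coking_elimination v G"
  define down where "down p = (\<lambda>i. if p i > p v then p i - 1 else p i)" for p :: "'n \<Rightarrow> int"
  define up where "up p = (\<lambda>i. if p i > p v then p i + 1 else p i)" for p :: "'n \<Rightarrow> int"
  have le: "lower G i \<le> 0" "0 \<le> upper G i" for i using zero[of i] by (auto simp: weight_def)
  \<comment> \<open>If the interval in \<open>sub\<close> is empty, both endpoints of
    \<open>weight G i\<close> are \<open>0\<close>, and the bounds follow from \<open>0\<close>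
    being in \<open>weight G v\<close>.\<close>
  have low: "lower G v \<le> lower G i" and upp: "upper G i - 1 \<le> upper G v" if "i \<noteq> v" for i
    using sub[OF that] le[of i] le[of v] by (auto simp: weight_def)
  \<comment> \<open>The coking property: the edge from \<open>i\<close> to \<open>v\<close> forbids
    exactly the position after \<open>p v\<close>.\<close>
  have gap: "p i \<noteq> p v + 1" if "p \<in> box_points q G" for p i
    using that \<open>coking G v\<close> by (cases "i = v") (fastforce simp: box_points_def coking_def)+
  have ne: "p i \<noteq> p v" if "inj p" "i \<noteq> v" for p :: "'n \<Rightarrow> int" and i
    using that by (auto dest: injD)
  have down_mem: "down p \<in> box_points q ?G'" if p: "p \<in> box_points q G" for p
  proof -
    have b: "upper G i < p i" "p i < q + lower G i" and "inj p"
      and e: "\<And>i j. (i, j) \<in> dedges G \<Longrightarrow> p i - p j \<noteq> 1" for i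
      using p by (auto simp: box_points_def)
    have "upper ?G' i < down p i \<and> down p i < q + lower ?G' i" for i
    proof (cases "i = v")
      case True
      then show ?thesis using b[of v] by (simp add: down_def coking_elimination_def)
    next
      case False
      \<comment> \<open>If \<open>p i > p v\<close>, then \<open>p i - 1\<close> is at least
        \<open>p v + 1\<close> by \<open>gap\<close>, hence exceeds \<open>upper G i\<close> by
        \<open>upp\<close>. If \<open>p i < p v\<close>, the coordinate is unchanged and meets the
        tightened upper bound by \<open>low\<close>.\<close>
      show ?thesis
        using False b[of i] b[of v] low[OF False] upp[OF False] gap[OF p, of i] ne[OF \<open>inj p\<close> False]
        by (auto simp: down_def coking_elimination_def)
    qed
    moreover have "inj (down p)"
    proof (rule injI)
      fix i j assume "down p i = down p j"
      \<comment> \<open>A collision would require a coordinate at \<open>p v + 1\<close> to drop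
        onto \<open>p v\<close>.\<close>
      then have "p i = p j" using gap[OF p, of i] gap[OF p, of j]
        by (auto simp: down_def split: if_splits)
      then show "i = j" using \<open>inj p\<close> by (auto dest: injD)
    qed
    moreover have "down p i - down p j \<noteq> 1" if "(i, j) \<in> dedges ?G'" for i j
    proof -
      \<comment> \<open>Elimination removes the edges into \<open>v\<close> from other vertices, and
        a loop at \<open>v\<close> is excluded by \<open>vw_digraph\<close>.\<close>
      have ij: "(i, j) \<in> dedges G" "j \<noteq> v"
        using that \<open>vw_digraph G\<close> by (auto simp: coking_elimination_def vw_digraph_def)
      then show ?thesis
        using e[of i j] ne[OF \<open>inj p\<close> ij(2)] gap[OF p, of i]
        by (auto simp: down_def)
    qed
    ultimately show ?thesis unfolding box_points_def by auto
  qed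
  have up_mem: "up p \<in> box_points q G" if p: "p \<in> box_points q ?G'" for p
  proof -
    have b: "upper G i < p i" "p i < q + lower ?G' i" and "inj p"
      and e: "\<And>i j. (i, j) \<in> dedges ?G' \<Longrightarrow> p i - p j \<noteq> 1" for i
      using p by (auto simp: box_points_def coking_elimination_def)
    have "upper G i < up p i \<and> up p i < q + lower G i" for i
      using b[of i] by (auto simp: up_def coking_elimination_def split: if_splits)
    moreover have "inj (up p)"
    proof (rule injI)
      fix i j assume "up p i = up p j"
      then have "p i = p j" by (auto simp: up_def split: if_splits)
      then show "i = j" using \<open>inj p\<close> by (auto dest: injD)
    qed
    moreover have "up p i - up p j \<noteq> 1" if "(i, j) \<in> dedges G" for i j
    proof (cases "j = v")
      case True
      \<comment> \<open>The edges into \<open>v\<close> are satisfied because \<open>up\<close>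
        leaves the position \<open>p v + 1\<close> vacant.\<close>
      then show ?thesis by (auto simp: up_def)
    next
      case False
      then have "(i, j) \<in> dedges ?G'" using that by (auto simp: coking_elimination_def)
      then show ?thesis using e[of i j] ne[OF \<open>inj p\<close> False] by (auto simp: up_def)
    qed
    ultimately show ?thesis unfolding box_points_def by auto
  qed
  have "bij_betw down (box_points q G) (box_points q ?G')"
  proof (rule bij_betw_byWitness[where f' = up])
    have "up (down p) i = p i" if "p \<in> box_points q G" for p i
      using gap[OF that, of i] by (auto simp: up_def down_def)
    then show "\<forall>p\<in>box_points q G. up (down p) = p" by auto
    show "\<forall>p\<in>box_points q ?G'. down (up p) = p" by (auto simp: up_def down_def)
  qed (use down_mem up_mem in auto)
  then show ?thesis by (rule bij_betw_same_card)
qed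

section \<open>Reflection, which exchanges kings and cokings\<close>

definition reflection :: "'n vwdigraph \<Rightarrow> 'n vwdigraph" where
  "reflection G = \<lparr>dedges = (dedges G)\<inverse>, lower = (\<lambda>i. - upper G i), upper = (\<lambda>i. - lower G i)\<rparr>"

lemma box_points_reflection:
  assumes "p \<in> box_points q G"
  shows "(\<lambda>i. q - p i) \<in> box_points q (reflection G)"
proof -
  have "inj (\<lambda>i. q - p i)" using assms by (auto simp: box_points_def inj_def)
  moreover have "(q - p j) - (q - p i) \<noteq> 1" if "(i, j) \<in> dedges G" for i j
    using that assms by (auto simp: box_points_def)
  moreover have "- lower G i < q - p i \<and> q - p i < q - upper G i" for i
    using assms by (simp add: box_points_def less_diff_eq diff_less_eq)
  ultimately show ?thesis by (auto simp: box_points_def reflection_def)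
qed

lemma reflection_reflection: "reflection (reflection G) = G"
  by (simp add: reflection_def)

lemma card_box_points_reflection: "card (box_points q (reflection G)) = card (box_points q G)"
proof -
  have "bij_betw (\<lambda>p i. q - p i) (box_points q (reflection G)) (box_points q G)"
    by (rule bij_betw_byWitness[where f' = "\<lambda>p i. q - p i"])
      (use box_points_reflection[of _ q G] box_points_reflection[of _ q "reflection G"] in
        \<open>auto simp: reflection_reflection\<close>)
  then show ?thesis by (rule bij_betw_same_card)
qed

text \<open>Conjugating with \<open>reflection\<close> turns raised upper endpoints into lowered
  lower endpoints, so king elimination becomes coking elimination, and \<open>sub\<close> becomes
  the corresponding hypothesis there.\<close>

lemma card_box_points_king_elimination:
  assumes "vw_digraph G" "king G v" "\<And>i. 0 \<in> weight G i"
    and sub: "\<And>i. i \<noteq> v \<Longrightarrow> {lower G i + 1..upper G i} \<subseteq> weight G v"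
  shows "card (box_points q G) = card (box_points q (king_elimination v G))"
proof -
  have "card (box_points q (reflection G)) = card (box_points q (coking_elimination v (reflection G)))"
  proof (rule card_box_points_coking_elimination)
    show "{lower (reflection G) i..upper (reflection G) i - 1} \<subseteq> weight (reflection G) v"
      if "i \<noteq> v" for i
    proof
      fix c assume "c \<in> {lower (reflection G) i..upper (reflection G) i - 1}"
      then have "- c \<in> {lower G i + 1..upper G i}" by (auto simp: reflection_def)
      then have "- c \<in> weight G v" using sub[OF that] by blast
      then show "c \<in> weight (reflection G) v" by (auto simp: reflection_def weight_def)
    qed
  qed (use assms in \<open>auto simp: reflection_def vw_digraph_def coking_def king_def weight_def\<close>)
  also have "coking_elimination v (reflection G) = reflection (king_elimination v G)"
    by (auto simp: coking_elimination_def king_elimination_def reflection_def fun_eq_iff)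
  finally show ?thesis by (simp only: card_box_points_reflection)
qed

theorem theorem3p1:
  fixes G :: "'n::finite vwdigraph" and v :: 'n
  assumes "vw_digraph G"
  shows "(coking G v \<longrightarrow>
          (\<forall>i. 0 \<in> weight G i) \<longrightarrow>
          (\<forall>i. i \<noteq> v \<longrightarrow> {lower G i..upper G i - 1} \<subseteq> weight G v) \<longrightarrow>
          char_poly (digraphical_arrangement G) =
          char_poly (digraphical_arrangement (coking_elimination v G))) \<and>
         (king G v \<longrightarrow>
          (\<forall>i. 0 \<in> weight G i) \<longrightarrow>
          (\<forall>i. i \<noteq> v \<longrightarrow> {lower G i + 1..upper G i} \<subseteq> weight G v) \<longrightarrow>
          char_poly (digraphical_arrangement G) =
          char_poly (digraphical_arrangement (king_elimination v G)))"
proof (intro conjI impI)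
  assume c: "coking G v" and z: "\<forall>i. 0 \<in> weight G i"
    and s: "\<forall>i. i \<noteq> v \<longrightarrow> {lower G i..upper G i - 1} \<subseteq> weight G v"
  \<comment> \<open>Elimination only enlarges the intervals, so \<open>0\<close> stays in each of
    them.\<close>
  have z': "0 \<in> weight (coking_elimination v G) i" for i
    using z[rule_format, of i] by (auto simp: weight_def coking_elimination_def)
  have "lower (coking_elimination v G) i \<le> upper (coking_elimination v G) i" for i
    using z'[of i] by (simp add: weight_def)
  then have "vw_digraph (coking_elimination v G)"
    using assms by (auto simp: vw_digraph_def coking_elimination_def)
  then show "char_poly (digraphical_arrangement G) =
      char_poly (digraphical_arrangement (coking_elimination v G))"
    using assms c z z' s by (intro char_poly_eqI card_box_points_coking_elimination) auto
next
  assume c: "king G v" and z: "\<forall>i. 0 \<in> weight G i"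
    and s: "\<forall>i. i \<noteq> v \<longrightarrow> {lower G i + 1..upper G i} \<subseteq> weight G v"
  have z': "0 \<in> weight (king_elimination v G) i" for i
    using z[rule_format, of i] by (auto simp: weight_def king_elimination_def)
  have "lower (king_elimination v G) i \<le> upper (king_elimination v G) i" for i
    using z'[of i] by (simp add: weight_def)
  then have "vw_digraph (king_elimination v G)"
    using assms by (auto simp: vw_digraph_def king_elimination_def)
  then show "char_poly (digraphical_arrangement G) =
      char_poly (digraphical_arrangement (king_elimination v G))"
    using assms c z z' s by (intro char_poly_eqI card_box_points_king_elimination) auto
qed

end
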